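(* Let $(E;\oplus,0)$ be a generalized effect algebra and let $S$ be a set of generalized states on $E$. Then there exists a morphism $\varphi_S:E\to \mathcal{G}_{\mathcal{E}_{lin}(S)}(l_2(S))$ such that for every $s\in S$ there is a vector $\mathbf{x}_s\in \mathcal{E}_{lin}(S)$ satisfying $s=\omega_{\mathbf{x}_s}\circ\varphi_S$. Moreover, for this $\varphi_S$: (i) $\varphi_S:(E,\tau_E^{S})\to (\mathcal{G}_{\mathcal{E}_{lin}(S)}(l_2(S)),\tau_{\mathcal{E}_{lin}(S)})$ is a continuous map; (ii) there is an index set $T$ and a family $\mathcal{F}=\{f_t\}_{t\in T}$ of continuous maps $f_t:E\to[0,1]$ (where $E$ carries the topology $\tau_E^S$) that separates points and closed sets; (iii) if $S$ separates points, then $\varphi_S$ is injective and the topology $\tau_E^{S}$ is Tychonoff; (iv) if $S$ is order determining, then $\varphi_S$ is order reflecting; (v) if $S$ is bounded, then for every $a\in E$ the operator $\varphi_S(a)$ is bounded.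
   Context: A generalized effect algebra $(E;\oplus,0)$ is a set $E$ with an element $0\in E$ and a partial binary operation $\oplus$ such that for all $x,y,z\in E$: (GE1) $x\oplus y=y\oplus x$ if one side is defined; (GE2) $(x\oplus y)\oplus z=x\oplus(y\oplus z)$ if one side is defined; (GE3) $x\oplus y=x\oplus z$ implies $y=z$; (GE4) $x\oplus y=0$ implies $x=y=0$; (GE5) $x\oplus 0=x$. The partial order is: $x\le y$ iff there is $z$ with $x\oplus z$ defined and $x\oplus z=y$. A morphism $f:E_1\to E_2$ of generalized effect algebras is a map such that whenever $a\oplus_1 b$ is defined, $f(a)\oplus_2 f(b)$ is defined and equals $f(a\oplus_1 b)$. A morphism $f$ is order reflecting if $f(a)\le f(b)$ implies $a\le b$ for all $a,b\in E_1$. For a complex Hilbert space $\mathcal{H}$ (inner product linear in the second argument) and a dense linear subspace $D\subseteq\mathcal{H}$, $\mathcal{G}_D(\mathcal{H})$ is the set of all positive linear operators $A:D\to\mathcal{H}$ (i.e. $\langle \mathbf{x},A\mathbf{x}\rangle\ge 0$ for all $\mathbf{x}\in D$); with $\oplus$ the usual (everywhere defined) sum of operators on $D$ and $0$ the null operator it is a generalized effect algebra, in which $A\le B$ iff $B-A$ is positive. For a set $M$, $l_2(M)$ is the Hilbert space of square-summable families $(x_m)_{m\in M}$ of complex numbers with $\langle (x_m),(y_m)\rangle=\sum_{m\in M}\overline{x}_m y_m$, and $\mathcal{E}_{lin}(M)$ is its dense subspace of families with only finitely many nonzero entries. $\mathbb{R}^+_0$ is the set of nonnegative reals, a generalized effect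 algebra under usual addition. A generalized state on $E$ is a morphism $s:E\to\mathbb{R}^+_0$. For $\mathbf{x}\in D$, the generalized vector state $\omega_{\mathbf{x}}:\mathcal{G}_D(\mathcal{H})\to\mathbb{R}^+_0$ is $\omega_{\mathbf{x}}(A)=\langle\mathbf{x},A\mathbf{x}\rangle$. A set $S$ of generalized states on $E$: separates points if ($s(a)=s(b)$ for all $s\in S$) implies $a=b$, for all $a,b\in E$; is order determining if ($s(a)\le s(b)$ for all $s\in S$) implies $a\le b$, for all $a,b\in E$; is bounded if for each $a\in E$ there is $c_a>0$ with $s(a)\le c_a$ for all $s\in S$. The topology $\tau_E^S$ is the weak topology on $E$ generated by the family of maps $s:E\to\mathbb{R}^+_0$, $s\in S$ (with $\mathbb{R}^+_0$ carrying the Euclidean topology). For $E=\mathcal{G}_D(\mathcal{H})$ and $S$ the set of all generalized vector states $\omega_{\mathbf{x}}$, $\mathbf{x}\in D$, this topology is denoted $\tau_D$. A family $\{f_t\}_{t\in T}$ of continuous maps $f_t:X\to Y_t$ separates points and closed sets if for every $x\in X$ and every closed $G\subseteq X$ with $x\notin G$ there is $t\in T$ with $f_t(x)\notin\overline{f_t(G)}$. *)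

theory Defs
  imports "HOL-Analysis.Analysis"
begin

section \<open>Generalized effect algebras\<close>

text \<open>The partial operation returns \<open>None\<close> where it is undefined.\<close>

record 'a partial_algebra =
  carrier :: "'a set"
  oplus :: "'a \<Rightarrow> 'a \<Rightarrow> 'a option"
  pzero :: 'a

text \<open>Equality of options is equality ``if one side is defined'': both sides are undefined, or
  both are defined and equal.\<close>

definition generalized_effect_algebra :: "'a partial_algebra \<Rightarrow> bool" where
  "generalized_effect_algebra E \<longleftrightarrow>
     pzero E \<in> carrier E \<and>
     (\<forall>x\<in>carrier E. \<forall>y\<in>carrier E. \<forall>z. oplus E x y = Some z \<longrightarrow> z \<in> carrier E) \<and>
     (\<forall>x\<in>carrier E. \<forall>y\<in>carrier E. oplus E x y = oplus E y x) \<and>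
     (\<forall>x\<in>carrier E. \<forall>y\<in>carrier E. \<forall>z\<in>carrier E.
        Option.bind (oplus E x y) (\<lambda>u. oplus E u z) =
        Option.bind (oplus E y z) (\<lambda>v. oplus E x v)) \<and>
     (\<forall>x\<in>carrier E. \<forall>y\<in>carrier E. \<forall>z\<in>carrier E. \<forall>w.
        oplus E x y = Some w \<and> oplus E x z = Some w \<longrightarrow> y = z) \<and>
     (\<forall>x\<in>carrier E. \<forall>y\<in>carrier E.
        oplus E x y = Some (pzero E) \<longrightarrow> x = pzero E \<and> y = pzero E) \<and>
     (\<forall>x\<in>carrier E. oplus E x (pzero E) = Some x)"

definition pa_le :: "'a partial_algebra \<Rightarrow> 'a \<Rightarrow> 'a \<Rightarrow> bool" where
  "pa_le E x y \<longleftrightarrow> (\<exists>z\<in>carrier E. oplus E x z = Some y)"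

definition morphism :: "'a partial_algebra \<Rightarrow> 'b partial_algebra \<Rightarrow> ('a \<Rightarrow> 'b) \<Rightarrow> bool" where
  "morphism E F f \<longleftrightarrow>
     f \<in> carrier E \<rightarrow> carrier F \<and>
     (\<forall>a\<in>carrier E. \<forall>b\<in>carrier E. \<forall>c.
        oplus E a b = Some c \<longrightarrow> oplus F (f a) (f b) = Some (f c))"

definition order_reflecting :: "'a partial_algebra \<Rightarrow> 'b partial_algebra \<Rightarrow> ('a \<Rightarrow> 'b) \<Rightarrow> bool" where
  "order_reflecting E F f \<longleftrightarrow>
     (\<forall>a\<in>carrier E. \<forall>b\<in>carrier E. pa_le F (f a) (f b) \<longrightarrow> pa_le E a b)"


section \<open>Generalized states\<close>

definition nonneg_reals_algebra :: "real partial_algebra" where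
  "nonneg_reals_algebra =
     \<lparr>carrier = {0..}, oplus = (\<lambda>x y. Some (x + y)), pzero = 0\<rparr>"

text \<open>Being \<^term>\<open>extensional\<close>, two generalized states are equal as HOL functions iff they agree on
  the carrier, so a set of generalized states has no repeated members.\<close>

definition generalized_states :: "'a partial_algebra \<Rightarrow> ('a \<Rightarrow> real) set" where
  "generalized_states E =
     {s \<in> extensional (carrier E). morphism E nonneg_reals_algebra s}"

definition separates_points :: "'a partial_algebra \<Rightarrow> ('a \<Rightarrow> real) set \<Rightarrow> bool" where
  "separates_points E S \<longleftrightarrow>
     (\<forall>a\<in>carrier E. \<forall>b\<in>carrier E. (\<forall>s\<in>S. s a = s b) \<longrightarrow> a = b)"

definition order_determining :: "'a partial_algebra \<Rightarrow> ('a \<Rightarrow> real) set \<Rightarrow> bool" where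
  "order_determining E S \<longleftrightarrow>
     (\<forall>a\<in>carrier E. \<forall>b\<in>carrier E. (\<forall>s\<in>S. s a \<le> s b) \<longrightarrow> pa_le E a b)"

definition bounded_states :: "'a partial_algebra \<Rightarrow> ('a \<Rightarrow> real) set \<Rightarrow> bool" where
  "bounded_states E S \<longleftrightarrow> (\<forall>a\<in>carrier E. \<exists>c>0. \<forall>s\<in>S. s a \<le> c)"

text \<open>The carrier is added to the subbase so that it is the underlying set also when \<open>S\<close> is empty.\<close>

definition weak_topology :: "'a partial_algebra \<Rightarrow> ('a \<Rightarrow> real) set \<Rightarrow> 'a topology" where
  "weak_topology E S =
     topology_generated_by
       (insert (carrier E)
         {{a \<in> carrier E. s a \<in> U} |s U. s \<in> S \<and> openin (top_of_set {0..}) U})"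


section \<open>Positive operators on a subspace of a complex inner product space\<close>

text \<open>The inner product is linear in its second argument.\<close>

record 'v inner_space =
  vectors :: "'v set"
  vadd :: "'v \<Rightarrow> 'v \<Rightarrow> 'v"
  vscale :: "complex \<Rightarrow> 'v \<Rightarrow> 'v"
  vzero :: 'v
  vinner :: "'v \<Rightarrow> 'v \<Rightarrow> complex"

definition vnorm :: "'v inner_space \<Rightarrow> 'v \<Rightarrow> real" where
  "vnorm H x = sqrt (Re (vinner H x x))"

definition linear_operator :: "'v inner_space \<Rightarrow> 'v set \<Rightarrow> ('v \<Rightarrow> 'v) \<Rightarrow> bool" where
  "linear_operator H D A \<longleftrightarrow>
     A \<in> D \<rightarrow>\<^sub>E vectors H \<and>
     (\<forall>x\<in>D. \<forall>y\<in>D. A (vadd H x y) = vadd H (A x) (A y)) \<and>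
     (\<forall>c. \<forall>x\<in>D. A (vscale H c x) = vscale H c (A x))"

definition positive_operator :: "'v inner_space \<Rightarrow> 'v set \<Rightarrow> ('v \<Rightarrow> 'v) \<Rightarrow> bool" where
  "positive_operator H D A \<longleftrightarrow>
     linear_operator H D A \<and> (\<forall>x\<in>D. vinner H x (A x) \<in> \<real>\<^sub>\<ge>\<^sub>0)"

definition bounded_operator :: "'v inner_space \<Rightarrow> 'v set \<Rightarrow> ('v \<Rightarrow> 'v) \<Rightarrow> bool" where
  "bounded_operator H D A \<longleftrightarrow>
     linear_operator H D A \<and> (\<exists>c. \<forall>x\<in>D. vnorm H (A x) \<le> c * vnorm H x)"

definition positive_operators ::
    "'v inner_space \<Rightarrow> 'v set \<Rightarrow> ('v \<Rightarrow> 'v) partial_algebra" where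
  "positive_operators H D =
     \<lparr>carrier = {A. positive_operator H D A},
      oplus = (\<lambda>A B. Some (\<lambda>x\<in>D. vadd H (A x) (B x))),
      pzero = (\<lambda>x\<in>D. vzero H)\<rparr>"

definition vector_state :: "'v inner_space \<Rightarrow> 'v set \<Rightarrow> 'v \<Rightarrow> ('v \<Rightarrow> 'v) \<Rightarrow> real" where
  "vector_state H D x = (\<lambda>A\<in>carrier (positive_operators H D). Re (vinner H x (A x)))"

definition vector_states :: "'v inner_space \<Rightarrow> 'v set \<Rightarrow> (('v \<Rightarrow> 'v) \<Rightarrow> real) set" where
  "vector_states H D = vector_state H D ` D"

definition operator_topology :: "'v inner_space \<Rightarrow> 'v set \<Rightarrow> ('v \<Rightarrow> 'v) topology" where
  "operator_topology H D = weak_topology (positive_operators H D) (vector_states H D)"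


section \<open>The Hilbert space of square-summable families\<close>

text \<open>A family indexed by \<open>M\<close> is a function on the whole index type that vanishes outside \<open>M\<close>.\<close>

definition l2 :: "'m set \<Rightarrow> ('m \<Rightarrow> complex) inner_space" where
  "l2 M =
     \<lparr>vectors = {x. (\<forall>m. m \<notin> M \<longrightarrow> x m = 0) \<and> (\<lambda>m. (cmod (x m))\<^sup>2) summable_on M},
      vadd = (\<lambda>x y m. x m + y m),
      vscale = (\<lambda>c x m. c * x m),
      vzero = (\<lambda>m. 0),
      vinner = (\<lambda>x y. \<Sum>\<^sub>\<infinity>m\<in>M. cnj (x m) * y m)\<rparr>"

definition E_lin :: "'m set \<Rightarrow> ('m \<Rightarrow> complex) set" where
  "E_lin M = {x \<in> vectors (l2 M). finite {m \<in> M. x m \<noteq> 0}}"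


section \<open>Topological notions\<close>

text \<open>If all \<open>Y t\<close> are equal, the property depends only on the set of functions \<open>f ` T\<close>; hence an
  existential quantifier over such families of maps \<open>'a \<Rightarrow> real\<close> loses nothing by using
  \<open>'a \<Rightarrow> real\<close> as the type of indices.\<close>

definition separates_points_and_closed_sets ::
    "'a topology \<Rightarrow> ('t \<Rightarrow> 'b topology) \<Rightarrow> 't set \<Rightarrow> ('t \<Rightarrow> 'a \<Rightarrow> 'b) \<Rightarrow> bool" where
  "separates_points_and_closed_sets X Y T f \<longleftrightarrow>
     (\<forall>x\<in>topspace X. \<forall>G. closedin X G \<and> x \<notin> G \<longrightarrow>
        (\<exists>t\<in>T. f t x \<notin> Y t closure_of (f t ` G)))"

definition tychonoff_space :: "'a topology \<Rightarrow> bool" where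
  "tychonoff_space X \<longleftrightarrow> t1_space X \<and> completely_regular_space X"


section \<open>The structures above are generalized effect algebras\<close>

lemma topspace_weak_topology: "topspace (weak_topology E S) = carrier E"
  unfolding weak_topology_def topology_generated_by_topspace by auto

lemma generalized_effect_algebra_nonneg_reals:
  "generalized_effect_algebra nonneg_reals_algebra"
  unfolding generalized_effect_algebra_def nonneg_reals_algebra_def by auto

lemma l2_add_closed:
  assumes "x \<in> vectors (l2 M)" "y \<in> vectors (l2 M)"
  shows "vadd (l2 M) x y \<in> vectors (l2 M)"
proof -
  have "(\<lambda>m. 2 * ((cmod (x m))\<^sup>2 + (cmod (y m))\<^sup>2)) summable_on M"
    using assms by (intro summable_on_cmult_right summable_on_add) (auto simp: l2_def)
  moreover have "(cmod (x m + y m))\<^sup>2 \<le> 2 * ((cmod (x m))\<^sup>2 + (cmod (y m))\<^sup>2)" for m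
  proof -
    have "(cmod (x m + y m))\<^sup>2 \<le> (cmod (x m) + cmod (y m))\<^sup>2"
      by (intro power_mono norm_triangle_ineq) auto
    also have "\<dots> \<le> 2 * ((cmod (x m))\<^sup>2 + (cmod (y m))\<^sup>2)"
      using sum_squares_bound[of "cmod (x m)" "cmod (y m)"] by (simp add: power2_sum)
    finally show ?thesis .
  qed
  ultimately have "(\<lambda>m. (cmod (x m + y m))\<^sup>2) summable_on M"
    by (rule summable_on_comparison_test) auto
  then show ?thesis
    using assms by (auto simp: l2_def)
qed

lemma l2_scale_closed:
  "x \<in> vectors (l2 M) \<Longrightarrow> vscale (l2 M) c x \<in> vectors (l2 M)"
  by (auto simp: l2_def norm_mult power_mult_distrib intro: summable_on_cmult_right)

lemma E_lin_closed:
  assumes "x \<in> E_lin M" "y \<in> E_lin M"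
  shows "vadd (l2 M) x y \<in> E_lin M" "vscale (l2 M) c x \<in> E_lin M"
proof -
  have f: "finite {m \<in> M. x m \<noteq> 0}" "finite {m \<in> M. y m \<noteq> 0}"
    using assms by (auto simp: E_lin_def)
  have "finite {m \<in> M. x m + y m \<noteq> 0}"
    by (rule finite_subset[OF _ finite_UnI[OF f]]) auto
  then show "vadd (l2 M) x y \<in> E_lin M"
    using assms l2_add_closed[of x M y] by (auto simp: E_lin_def l2_def)
  have "finite {m \<in> M. c * x m \<noteq> 0}"
    by (rule finite_subset[OF _ f(1)]) auto
  then show "vscale (l2 M) c x \<in> E_lin M"
    using assms l2_scale_closed[of x M c] by (auto simp: E_lin_def l2_def)
qed

lemma l2_inner_E_lin:
  assumes "x \<in> E_lin M"
  shows "(\<lambda>m. cnj (x m) * y m) summable_on M"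
proof -
  have "finite {m \<in> M. cnj (x m) * y m \<noteq> 0}"
    by (rule finite_subset[of _ "{m \<in> M. x m \<noteq> 0}"]) (use assms in \<open>auto simp: E_lin_def\<close>)
  then show ?thesis
    by (rule finite_nonzero_values_imp_summable_on)
qed

lemma l2_inner_add_right:
  assumes "x \<in> E_lin M"
  shows "vinner (l2 M) x (vadd (l2 M) y z) = vinner (l2 M) x y + vinner (l2 M) x z"
  using infsum_add[OF l2_inner_E_lin[OF assms, of y] l2_inner_E_lin[OF assms, of z]]
  by (simp add: l2_def algebra_simps)

lemma l2_inner_add_left:
  assumes "x \<in> E_lin M" "y \<in> E_lin M"
  shows "vinner (l2 M) (vadd (l2 M) x y) z = vinner (l2 M) x z + vinner (l2 M) y z"
  using infsum_add[OF l2_inner_E_lin[OF assms(1), of z] l2_inner_E_lin[OF assms(2), of z]]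
  by (simp add: l2_def algebra_simps)

lemma l2_inner_scale:
  "vinner (l2 M) x (vscale (l2 M) c y) = c * vinner (l2 M) x y"
  "vinner (l2 M) (vscale (l2 M) c x) y = cnj c * vinner (l2 M) x y"
  by (simp_all add: l2_def infsum_cmult_right' flip: mult.assoc)
     (simp_all add: mult.assoc mult.left_commute[of _ c] infsum_cmult_right')

lemma positive_operators_eq_zero:
  assumes A: "positive_operator (l2 M) (E_lin M) A"
    and 0: "\<And>x. x \<in> E_lin M \<Longrightarrow> vinner (l2 M) x (A x) = 0"
  shows "A = (\<lambda>x\<in>E_lin M. vzero (l2 M))"
proof
  let ?I = "vinner (l2 M)"
  have lin: "linear_operator (l2 M) (E_lin M) A"
    using A by (simp add: positive_operator_def)
  have polar: "?I x (A y) = 0" if x: "x \<in> E_lin M" and y: "y \<in> E_lin M" for x y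
  proof -
    have *: "c * ?I x (A y) + cnj c * ?I y (A x) = 0" for c
    proof -
      have cy: "vscale (l2 M) c y \<in> E_lin M"
        using E_lin_closed(2)[OF y y] .
      have "?I (vadd (l2 M) x (vscale (l2 M) c y)) (A (vadd (l2 M) x (vscale (l2 M) c y))) = 0"
        by (intro 0 E_lin_closed(1) x cy)
      moreover have "A (vadd (l2 M) x (vscale (l2 M) c y)) =
          vadd (l2 M) (A x) (vscale (l2 M) c (A y))"
        using lin x y cy by (simp add: linear_operator_def)
      ultimately show ?thesis
        using x y cy 0[OF x] 0[OF y]
        by (simp add: l2_inner_add_left l2_inner_add_right l2_inner_scale)
    qed
    have "\<i> * (?I x (A y) + ?I y (A x)) + (\<i> * ?I x (A y) - \<i> * ?I y (A x)) = 0"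
      using *[of 1] *[of \<i>] by simp
    then show ?thesis
      by (simp add: algebra_simps)
  qed
  show "A y = (\<lambda>x\<in>E_lin M. vzero (l2 M)) y" for y
  proof (cases "y \<in> E_lin M")
    case True
    then have Ay: "A y \<in> vectors (l2 M)"
      using lin by (auto simp: linear_operator_def)
    have "A y m = 0" for m
    proof (cases "m \<in> M")
      case m: True
      define e :: "'a \<Rightarrow> complex" where "e = (\<lambda>k. if k = m then 1 else 0)"
      have fin: "finite {k \<in> M. e k \<noteq> 0}" "finite {k \<in> M. (cmod (e k))\<^sup>2 \<noteq> 0}"
        by (rule finite_subset[of _ "{m}"]; auto simp: e_def)+
      have "e \<in> E_lin M"
        using fin finite_nonzero_values_imp_summable_on[OF fin(2)] m
        by (auto simp: E_lin_def l2_def e_def)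
      then have "0 = ?I e (A y)"
        using polar True by simp
      also have "\<dots> = (\<Sum>\<^sub>\<infinity>k\<in>{m}. cnj (e k) * A y k)"
        unfolding l2_def inner_space.simps
        by (rule infsum_cong_neutral) (use m in \<open>auto simp: e_def\<close>)
      finally show ?thesis
        by (simp add: e_def)
    qed (use Ay in \<open>auto simp: l2_def\<close>)
    then show ?thesis
      using True by (auto simp: l2_def)
  qed (use lin in \<open>auto simp: linear_operator_def\<close>)
qed

lemma positive_operator_add:
  assumes A: "positive_operator (l2 M) (E_lin M) A" and B: "positive_operator (l2 M) (E_lin M) B"
  shows "positive_operator (l2 M) (E_lin M) (\<lambda>x\<in>E_lin M. vadd (l2 M) (A x) (B x))"
proof -
  have "vadd (l2 M) (A x) (B x) \<in> vectors (l2 M)" if "x \<in> E_lin M" for x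
    using that A B by (intro l2_add_closed) (auto simp: positive_operator_def linear_operator_def)
  moreover have "vinner (l2 M) x (vadd (l2 M) (A x) (B x)) \<in> \<real>\<^sub>\<ge>\<^sub>0" if "x \<in> E_lin M" for x
    using that A B by (auto simp: l2_inner_add_right positive_operator_def intro: nonneg_Reals_add_I)
  moreover have "A (vadd (l2 M) x y) = vadd (l2 M) (A x) (A y)"
    "B (vadd (l2 M) x y) = vadd (l2 M) (B x) (B y)"
    "A (vscale (l2 M) c x) = vscale (l2 M) c (A x)"
    "B (vscale (l2 M) c x) = vscale (l2 M) c (B x)"
    if "x \<in> E_lin M" "y \<in> E_lin M" for x y c
    using that A B by (auto simp: positive_operator_def linear_operator_def)
  ultimately show ?thesis
    using E_lin_closed[of _ M]
    by (auto simp: positive_operator_def linear_operator_def) (auto simp: l2_def algebra_simps)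
qed

theorem generalized_effect_algebra_positive_operators:
  "generalized_effect_algebra (positive_operators (l2 M) (E_lin M))"
proof -
  let ?P = "positive_operator (l2 M) (E_lin M)"
  let ?add = "\<lambda>A B. \<lambda>x\<in>E_lin M. vadd (l2 M) (A x) (B x)"
  let ?O = "\<lambda>x\<in>E_lin M. vzero (l2 M)"
  have ext: "A \<in> extensional (E_lin M)" if "?P A" for A
    using that by (auto simp: positive_operator_def linear_operator_def PiE_def)
  have zero: "?P ?O"
    using E_lin_closed[of _ M]
    by (auto simp: positive_operator_def linear_operator_def) (auto simp: l2_def)
  have comm: "?add A B = ?add B A" for A B
    by (auto simp: l2_def fun_eq_iff)
  have assoc: "?add (?add A B) C = ?add A (?add B C)" for A B C
    by (auto simp: l2_def fun_eq_iff)
  have cancel: "B = C" if "?add A B = ?add A C" "?P B" "?P C" for A B C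
  proof (rule extensionalityI[OF ext[OF that(2)] ext[OF that(3)]])
    fix x assume x: "x \<in> E_lin M"
    show "B x = C x"
      using fun_cong[OF that(1), of x] x by (simp add: l2_def fun_eq_iff)
  qed
  have zerosum: "A = ?O" if s: "?add A B = ?O" and A: "?P A" and B: "?P B" for A B
  proof (rule positive_operators_eq_zero[OF A])
    fix x assume x: "x \<in> E_lin M"
    have "vadd (l2 M) (A x) (B x) = vzero (l2 M)"
      using fun_cong[OF s, of x] x by simp
    then have "vinner (l2 M) x (A x) + vinner (l2 M) x (B x) = 0"
      using x by (simp flip: l2_inner_add_right) (simp add: l2_def)
    then show "vinner (l2 M) x (A x) = 0"
      using A B x
      by (auto simp: positive_operator_def complex_nonneg_Reals_iff complex_eq_iff
               dest!: bspec[where x = x])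
  qed
  have zerosum': "B = ?O" if "?add A B = ?O" "?P A" "?P B" for A B
    using zerosum[of B A] that comm[of A B] by simp
  have neutral: "?add A ?O = A" if "?P A" for A
    using ext[OF that] by (intro extensionalityI[of _ "E_lin M"]) (auto simp: l2_def)
  show ?thesis
    unfolding generalized_effect_algebra_def positive_operators_def
      partial_algebra.simps mem_Collect_eq bind.simps option.inject
    using zero positive_operator_add[of M] comm assoc cancel zerosum zerosum' neutral
    by (intro conjI ballI allI impI) blast+
qed

end

theory Submission
  imports Defs
begin

text \<open>The morphism sends \<open>a\<close> to the diagonal operator with entries \<open>s a\<close>, \<open>s \<in> S\<close>. Its value under
  the vector state of a finitely supported \<open>x\<close> is the finite sum of the \<open>s a \<cdot> |x\<^sub>s|\<^sup>2\<close>, and the state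
  \<open>s\<close> itself is recovered from the standard unit vector at \<open>s\<close>. The topology generated by \<open>S\<close> is
  pulled back from a product of real lines, hence completely regular.\<close>

section \<open>Diagonal operators and vector states on finitely supported families\<close>

definition diagonal_operator ::
    "'m set \<Rightarrow> ('m \<Rightarrow> real) \<Rightarrow> ('m \<Rightarrow> complex) \<Rightarrow> ('m \<Rightarrow> complex)" where
  "diagonal_operator M d = (\<lambda>x\<in>E_lin M. \<lambda>m. complex_of_real (d m) * x m)"

definition unit_vector :: "'m \<Rightarrow> 'm \<Rightarrow> complex" where
  "unit_vector k = (\<lambda>m. if m = k then 1 else 0)"

text \<open>Finite support makes the sum of squares finite, so the summability hidden in
  \<open>vectors (l2 M)\<close> need not be checked separately.\<close>

lemma E_linI:
  assumes "\<And>m. m \<notin> M \<Longrightarrow> x m = 0" and "finite {m \<in> M. x m \<noteq> 0}"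
  shows "x \<in> E_lin M"
proof -
  have "(\<lambda>m. (cmod (x m))\<^sup>2) summable_on M"
    using assms(2) by (intro finite_nonzero_values_imp_summable_on) simp
  with assms show ?thesis
    by (auto simp: E_lin_def l2_def)
qed

lemma E_lin_subset_vectors: "E_lin M \<subseteq> vectors (l2 M)"
  by (auto simp: E_lin_def)

lemma unit_vector_in_E_lin: "k \<in> M \<Longrightarrow> unit_vector k \<in> E_lin M"
  by (rule E_linI, auto simp: unit_vector_def)

text \<open>Multiplying entrywise cannot enlarge the support. Hence even an unbounded
  \<open>d\<close> gives an operator with values in \<open>l2 M\<close>.\<close>

lemma diagonal_operator_in_E_lin:
  assumes "x \<in> E_lin M"
  shows "diagonal_operator M d x \<in> E_lin M"
proof (rule E_linI)
  show "diagonal_operator M d x m = 0" if "m \<notin> M" for m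
    using assms that by (simp add: diagonal_operator_def E_lin_def l2_def)
  show "finite {m \<in> M. diagonal_operator M d x m \<noteq> 0}"
    by (rule finite_subset[of _ "{m \<in> M. x m \<noteq> 0}"])
      (use assms in \<open>auto simp: diagonal_operator_def E_lin_def\<close>)
qed

text \<open>All terms off the support of the left argument vanish; from here on, inner products are
  finite sums and raise no convergence questions.\<close>

lemma vinner_E_lin_eq_sum:
  assumes "x \<in> E_lin M"
  shows "vinner (l2 M) x y = (\<Sum>m\<in>{m \<in> M. x m \<noteq> 0}. cnj (x m) * y m)"
proof -
  have "vinner (l2 M) x y = (\<Sum>\<^sub>\<infinity>m\<in>{m \<in> M. x m \<noteq> 0}. cnj (x m) * y m)"
    unfolding l2_def inner_space.simps by (rule infsum_cong_neutral) auto
  with assms show ?thesis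
    by (simp add: E_lin_def)
qed

text \<open>Each term is \<open>d m\<close> times \<open>cnj (x m) * x m\<close>. Writing the value
  as \<open>complex_of_real\<close> of a sum lets both positivity and the vector state be read
  off.\<close>

lemma vinner_diagonal_operator:
  assumes "x \<in> E_lin M"
  shows "vinner (l2 M) x (diagonal_operator M d x) =
    complex_of_real (\<Sum>m\<in>{m \<in> M. x m \<noteq> 0}. d m * (cmod (x m))\<^sup>2)"
  unfolding vinner_E_lin_eq_sum[OF assms] of_real_sum
  by (rule sum.cong)
    (use assms in \<open>auto simp: diagonal_operator_def complex_norm_square mult_ac
      simp del: of_real_power\<close>)

lemma linear_operator_diagonal_operator:
  "linear_operator (l2 M) (E_lin M) (diagonal_operator M d)"
proof -
  have "diagonal_operator M d \<in> E_lin M \<rightarrow>\<^sub>E vectors (l2 M)"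
    using diagonal_operator_in_E_lin[of _ M d] E_lin_subset_vectors[of M]
    by (auto simp: PiE_def diagonal_operator_def)
  then show ?thesis
    using E_lin_closed[of _ M]
    by (auto simp: linear_operator_def diagonal_operator_def)
       (auto simp: l2_def algebra_simps)
qed

lemma positive_operator_diagonal_operator:
  assumes "\<And>m. m \<in> M \<Longrightarrow> 0 \<le> d m"
  shows "positive_operator (l2 M) (E_lin M) (diagonal_operator M d)"
  using assms
  by (auto simp: positive_operator_def linear_operator_diagonal_operator vinner_diagonal_operator
           intro!: sum_nonneg simp del: of_real_sum)

lemma vector_state_diagonal_operator:
  assumes "\<And>m. m \<in> M \<Longrightarrow> 0 \<le> d m" and "x \<in> E_lin M"
  shows "vector_state (l2 M) (E_lin M) x (diagonal_operator M d) =
    (\<Sum>m\<in>{m \<in> M. x m \<noteq> 0}. d m * (cmod (x m))\<^sup>2)"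
  using positive_operator_diagonal_operator[of M d, OF assms(1)] assms(2)
  by (simp add: vector_state_def positive_operators_def vinner_diagonal_operator del: of_real_sum)

lemma vector_state_unit_vector_diagonal_operator:
  assumes "\<And>m. m \<in> M \<Longrightarrow> 0 \<le> d m" and "k \<in> M"
  shows "vector_state (l2 M) (E_lin M) (unit_vector k) (diagonal_operator M d) = d k"
proof -
  have "{m \<in> M. unit_vector k m \<noteq> 0} = {k}"
    using assms(2) by (auto simp: unit_vector_def)
  then show ?thesis
    using vector_state_diagonal_operator[OF assms(1) unit_vector_in_E_lin[OF assms(2)]]
    by (simp add: unit_vector_def)
qed

text \<open>A common bound on the diagonal entries bounds the operator, since the squared norms
  compare term by term.\<close>

lemma bounded_operator_diagonal_operator:
  assumes "\<And>m. m \<in> M \<Longrightarrow> \<bar>d m\<bar> \<le> c"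
  shows "bounded_operator (l2 M) (E_lin M) (diagonal_operator M d)"
proof -
  \<comment> \<open>The factor is \<open>\<bar>c\<bar>\<close>, the square root of
    \<open>c\<^sup>2\<close>: for empty \<open>M\<close> the assumption does not exclude a negative
    \<open>c\<close>.\<close>
  have "vnorm (l2 M) (diagonal_operator M d x) \<le> \<bar>c\<bar> * vnorm (l2 M) x" if x: "x \<in> E_lin M" for x
  proof -
    let ?N = "{m \<in> M. x m \<noteq> 0}"
    have fin: "finite ?N"
      using x by (simp add: E_lin_def)
    have norm_x: "vinner (l2 M) x x = complex_of_real (\<Sum>m\<in>?N. (cmod (x m))\<^sup>2)"
      unfolding vinner_E_lin_eq_sum[OF x] of_real_sum
      by (rule sum.cong) (auto simp: complex_norm_square mult_ac simp del: of_real_power)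
    have "vinner (l2 M) (diagonal_operator M d x) (diagonal_operator M d x) =
        (\<Sum>m\<in>?N. complex_of_real (d m * d m * (cmod (x m))\<^sup>2))"
      unfolding vinner_E_lin_eq_sum[OF diagonal_operator_in_E_lin[OF x]]
      \<comment> \<open>The support of the image may be smaller than \<open>?N\<close>, as
        \<open>d\<close> may have zeros; the extra terms are zero.\<close>
      by (rule sum.mono_neutral_cong_left)
        (use x fin in \<open>auto simp: diagonal_operator_def complex_norm_square mult_ac
          simp del: of_real_power\<close>)
    then have "Re (vinner (l2 M) (diagonal_operator M d x) (diagonal_operator M d x)) =
        (\<Sum>m\<in>?N. (d m)\<^sup>2 * (cmod (x m))\<^sup>2)"
      by (simp add: power2_eq_square[of "d _"])
    also have "\<dots> \<le> (\<Sum>m\<in>?N. c\<^sup>2 * (cmod (x m))\<^sup>2)"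
      using assms by (intro sum_mono mult_right_mono) (force simp flip: abs_le_square_iff)+
    also have "\<dots> = c\<^sup>2 * Re (vinner (l2 M) x x)"
      by (simp add: norm_x sum_distrib_left)
    finally show ?thesis
      unfolding vnorm_def real_sqrt_abs[symmetric] real_sqrt_mult[symmetric] by simp
  qed
  then show ?thesis
    using linear_operator_diagonal_operator by (auto simp: bounded_operator_def)
qed

text \<open>\<open>B\<close> is the sum of \<open>A\<close> and a positive operator, whose vector
  state adds a nonnegative amount. Order reflection rests on this.\<close>

lemma vector_state_mono:
  assumes "pa_le (positive_operators (l2 M) (E_lin M)) A B"
    and "A \<in> carrier (positive_operators (l2 M) (E_lin M))"
    and "B \<in> carrier (positive_operators (l2 M) (E_lin M))" and x: "x \<in> E_lin M"
  shows "vector_state (l2 M) (E_lin M) x A \<le> vector_state (l2 M) (E_lin M) x B"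
proof -
  obtain C where C: "positive_operator (l2 M) (E_lin M) C"
    and B: "B = (\<lambda>x\<in>E_lin M. vadd (l2 M) (A x) (C x))"
    using assms(1) by (auto simp: pa_le_def positive_operators_def)
  have "vinner (l2 M) x (B x) = vinner (l2 M) x (A x) + vinner (l2 M) x (C x)"
    using x by (simp add: B l2_inner_add_right)
  moreover have "0 \<le> Re (vinner (l2 M) x (C x))"
    using C x by (auto simp: positive_operator_def complex_nonneg_Reals_iff)
  ultimately show ?thesis
    using assms(2,3) by (simp add: vector_state_def)
qed

section \<open>Generalized states, the weak topology and its separation properties\<close>

lemma generalized_state_nonneg: "s \<in> generalized_states E \<Longrightarrow> a \<in> carrier E \<Longrightarrow> 0 \<le> s a"
  by (auto simp: generalized_states_def morphism_def nonneg_reals_algebra_def)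

lemma generalized_state_oplus:
  assumes "s \<in> generalized_states E" "a \<in> carrier E" "b \<in> carrier E" "oplus E a b = Some c"
  shows "s c = s a + s b"
  using assms by (auto simp: generalized_states_def morphism_def nonneg_reals_algebra_def)

lemma openin_weak_topology_vimage:
  assumes "s \<in> S" "openin (top_of_set {0..}) U"
  shows "openin (weak_topology E S) {a \<in> carrier E. s a \<in> U}"
  using assms unfolding weak_topology_def by (intro topology_generated_by_Basis) blast

lemma continuous_map_weak_topology_state:
  assumes "s \<in> S" "S \<subseteq> generalized_states E"
  shows "continuous_map (weak_topology E S) (top_of_set {0..}) s"
  using assms openin_weak_topology_vimage[OF assms(1)] generalized_state_nonneg[of s E]
  by (auto simp: continuous_map_def topspace_weak_topology)

text \<open>Universal property of the initial topology: continuity need only be tested on the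
  subbase, whose preimages are those of the composites with the generating maps.\<close>

lemma continuous_map_into_weak_topology:
  assumes "\<phi> \<in> topspace X \<rightarrow> carrier F"
    and "\<And>t. t \<in> R \<Longrightarrow> continuous_map X (top_of_set {0..}) (\<lambda>x. t (\<phi> x))"
  shows "continuous_map X (weak_topology F R) \<phi>"
  unfolding weak_topology_def
proof (rule continuous_on_generated_topo)
  fix U
  assume "U \<in> insert (carrier F)
    {{a \<in> carrier F. t a \<in> V} |t V. t \<in> R \<and> openin (top_of_set {0..}) V}"
  then consider "U = carrier F"
    | t V where "t \<in> R" "openin (top_of_set {0..}) V" "U = {a \<in> carrier F. t a \<in> V}"
    by auto
  then show "openin X (\<phi> -` U \<inter> topspace X)"
  proof cases
    case 1
    then have "\<phi> -` U \<inter> topspace X = topspace X"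
      using assms(1) by auto
    then show ?thesis
      by simp
  next
    case 2
    then have "\<phi> -` U \<inter> topspace X = {x \<in> topspace X. t (\<phi> x) \<in> V}"
      using assms(1) by auto
    then show ?thesis
      using assms(2)[OF 2(1)] 2(2) by (simp add: continuous_map_def)
  qed
next
  show "\<phi> ` topspace X \<subseteq> \<Union> (insert (carrier F)
    {{a \<in> carrier F. t a \<in> V} |t V. t \<in> R \<and> openin (top_of_set {0..}) V})"
    using assms(1) by auto
qed

text \<open>Evaluation at all states pulls the weak topology back from a power of the real line, and
  separating functions pull back along it. Evaluation may identify points, so it is not treated as
  an embedding.\<close>

lemma completely_regular_space_weak_topology:
  assumes S: "S \<subseteq> generalized_states E"
  shows "completely_regular_space (weak_topology E S)"
proof -
  let ?X = "weak_topology E S"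
  let ?P = "product_topology (\<lambda>_. euclideanreal) S"
  define ev where "ev = (\<lambda>a. \<lambda>s\<in>S. s a)"
  have euclid: "continuous_map ?X euclideanreal s" if "s \<in> S" for s
    using continuous_map_weak_topology_state[OF that S] continuous_map_into_fulltopology by blast
  have ev: "continuous_map ?X ?P ev"
    unfolding continuous_map_componentwise using euclid by (auto simp: ev_def)
  \<comment> \<open>Converse to continuity of \<open>ev\<close>: the pullback topology contains the
    subbase, hence the whole topology it generates.\<close>
  have preimage: "\<exists>V. openin ?P V \<and> U = ev -` V \<inter> carrier E" if "openin ?X U" for U
  proof -
    have "openin (pullback_topology (carrier E) ev ?P) U"
    proof (rule generate_topology_on_coarsest[OF istopology_openin])
      show "generate_topology_on (insert (carrier E)
          {{a \<in> carrier E. s a \<in> U} |s U. s \<in> S \<and> openin (top_of_set {0..}) U}) U"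
        using that by (simp add: weak_topology_def openin_topology_generated_by_iff)
      have "openin (pullback_topology (carrier E) ev ?P) {a \<in> carrier E. s a \<in> U}"
        if s: "s \<in> S" and U: "openin (top_of_set {0..}) U" for s U
      proof -
        \<comment> \<open>\<open>U\<close> is open only relative to the half-line; replacing it by
          \<open>V\<close> does not change the preimage because states are nonnegative.\<close>
        obtain V where V: "open V" "U = {0..} \<inter> V"
          using U by (auto simp: openin_open)
        have "openin ?P {g \<in> topspace ?P. g s \<in> V}"
          using continuous_map_product_projection[OF s, of "\<lambda>_. euclideanreal"] V(1)
          by (simp add: continuous_map_def)
        moreover have "{a \<in> carrier E. s a \<in> U} = ev -` {g \<in> topspace ?P. g s \<in> V} \<inter> carrier E"
          using V(2) s S generalized_state_nonneg[of s E] by (auto simp: ev_def)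
        ultimately show ?thesis
          unfolding openin_pullback_topology by blast
      qed
      moreover have "openin (pullback_topology (carrier E) ev ?P) (carrier E)"
        unfolding openin_pullback_topology
        by (rule exI[of _ "topspace ?P"], rule conjI[OF openin_topspace]) (auto simp: ev_def)
      ultimately show "openin (pullback_topology (carrier E) ev ?P) W"
        if "W \<in> insert (carrier E)
          {{a \<in> carrier E. s a \<in> U} |s U. s \<in> S \<and> openin (top_of_set {0..}) U}" for W
        using that by blast
    qed
    then show ?thesis
      by (simp add: openin_pullback_topology)
  qed
  have P: "completely_regular_space ?P"
    by (simp add: completely_regular_space_product_topology
      metrizable_imp_completely_regular_space metrizable_space_euclidean)
  show ?thesis
    unfolding completely_regular_space_def
  proof (intro allI impI)
    fix G a
    assume G: "closedin ?X G \<and> a \<in> topspace ?X - G"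
    then have a: "a \<in> carrier E" "a \<notin> G" and sub: "G \<subseteq> carrier E"
      and "openin ?X (carrier E - G)"
      by (auto simp: closedin_def topspace_weak_topology)
    then obtain V where V: "openin ?P V" "carrier E - G = ev -` V \<inter> carrier E"
      using preimage by blast
    \<comment> \<open>The image of \<open>G\<close> under \<open>ev\<close> may fail to be closed.
      The complement of \<open>V\<close> is a closed set that contains this image and misses
      \<open>ev a\<close>.\<close>
    have "closedin ?P (topspace ?P - V)"
      using V(1) by (rule openin_closedin_eq[THEN iffD1, THEN conjunct2])
    moreover have "ev a \<in> topspace ?P - (topspace ?P - V)"
      using V(2) a by (auto simp: ev_def)
    ultimately obtain f where f: "continuous_map ?P (top_of_set {0..1::real}) f" "f (ev a) = 0"
      "f ` (topspace ?P - V) \<subseteq> {1}"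
      using P unfolding completely_regular_space_def by meson
    have "ev ` G \<subseteq> topspace ?P - V"
      using sub V(2) by (auto simp: ev_def)
    then have "(f \<circ> ev) ` G \<subseteq> {1}"
      using f(3) unfolding image_comp[symmetric] by blast
    then show "\<exists>f. continuous_map ?X (top_of_set {0..1::real}) f \<and> f a = 0 \<and> f ` G \<subseteq> {1}"
      using continuous_map_compose[OF ev f(1)] f(2) by (intro exI[of _ "f \<circ> ev"]) auto
  qed
qed

text \<open>The family consists of all continuous maps to the unit interval, indexed by themselves.
  A map that is 1 on \<open>G\<close> stays 1 on the closure of the image, as \<open>{1}\<close> is
  closed, while it is 0 at \<open>x\<close>.\<close>

lemma completely_regular_imp_separates_points_and_closed_sets:
  assumes "completely_regular_space X"
  shows "separates_points_and_closed_sets X (\<lambda>t. top_of_set {0..1::real})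
    {f. continuous_map X (top_of_set {0..1}) f} id"
  unfolding separates_points_and_closed_sets_def
proof (intro ballI allI impI)
  fix x G
  assume "x \<in> topspace X" "closedin X G \<and> x \<notin> G"
  then obtain f where f: "continuous_map X (top_of_set {0..1::real}) f" "f x = 0" "f ` G \<subseteq> {1}"
    using assms unfolding completely_regular_space_def by (metis DiffI)
  have "closedin (top_of_set {0..1::real}) {1}"
    by (simp add: closed_subset)
  then have "top_of_set {0..1} closure_of (f ` G) \<subseteq> {1}"
    using f(3) by (simp add: closure_of_minimal)
  then have "f x \<notin> top_of_set {0..1} closure_of (f ` G)"
    using f(2) by auto
  with f(1) show "\<exists>t\<in>{f. continuous_map X (top_of_set {0..1::real}) f}.
      id t x \<notin> top_of_set {0..1} closure_of (id t ` G)"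
    by (auto intro!: exI[of _ f])
qed

text \<open>If \<open>s\<close> distinguishes \<open>a\<close> from \<open>b\<close>, deleting the
  value \<open>s b\<close> from the half-line leaves an open set whose preimage contains
  \<open>a\<close> but not \<open>b\<close>.\<close>

lemma t1_space_weak_topology:
  assumes "S \<subseteq> generalized_states E" "separates_points E S"
  shows "t1_space (weak_topology E S)"
  unfolding t1_space_def topspace_weak_topology
proof (intro ballI impI)
  fix a b
  assume ab: "a \<in> carrier E" "b \<in> carrier E" "a \<noteq> b"
  then obtain s where s: "s \<in> S" "s a \<noteq> s b"
    using assms(2) by (auto simp: separates_points_def)
  have "openin (top_of_set {0..}) ({0..} \<inter> - {s b})"
    by (intro openin_open_Int) auto
  then have "openin (weak_topology E S) {c \<in> carrier E. s c \<in> {0..} \<inter> - {s b}}"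
    by (rule openin_weak_topology_vimage[OF s(1)])
  then show "\<exists>U. openin (weak_topology E S) U \<and> a \<in> U \<and> b \<notin> U"
    by (intro exI[of _ "{c \<in> carrier E. s c \<in> {0..} \<inter> - {s b}}"] conjI)
      (use s ab assms(1) generalized_state_nonneg[of s E a] in auto)
qed

section \<open>The diagonal representation and its properties\<close>

theorem theorem3p1:
  fixes E :: "'a partial_algebra" and S :: "('a \<Rightarrow> real) set"
  assumes "generalized_effect_algebra E"
    and "S \<subseteq> generalized_states E"
  shows "\<exists>\<phi>.
    morphism E (positive_operators (l2 S) (E_lin S)) \<phi> \<and>
    (\<forall>s\<in>S. \<exists>x\<in>E_lin S. s = compose (carrier E) (vector_state (l2 S) (E_lin S) x) \<phi>) \<and>
    continuous_map (weak_topology E S) (operator_topology (l2 S) (E_lin S)) \<phi> \<and>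
    (\<exists>(T :: ('a \<Rightarrow> real) set) f.
       (\<forall>t\<in>T. continuous_map (weak_topology E S) (top_of_set {0..1::real}) (f t)) \<and>
       separates_points_and_closed_sets (weak_topology E S) (\<lambda>t. top_of_set {0..1}) T f) \<and>
    (separates_points E S \<longrightarrow>
       inj_on \<phi> (carrier E) \<and> tychonoff_space (weak_topology E S)) \<and>
    (order_determining E S \<longrightarrow>
       order_reflecting E (positive_operators (l2 S) (E_lin S)) \<phi>) \<and>
    (bounded_states E S \<longrightarrow>
       (\<forall>a\<in>carrier E. bounded_operator (l2 S) (E_lin S) (\<phi> a)))"
proof -
  let ?F = "positive_operators (l2 S) (E_lin S)"
  let ?X = "weak_topology E S"
  define \<phi> where "\<phi> a = diagonal_operator S (\<lambda>s. s a)" for a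
  have nonneg: "0 \<le> s a" if "s \<in> S" "a \<in> carrier E" for s a
    using that assms(2) generalized_state_nonneg[of s E a] by blast
  have carrier: "\<phi> a \<in> carrier ?F" if "a \<in> carrier E" for a
    using positive_operator_diagonal_operator[of S "\<lambda>s. s a"] nonneg that
    by (simp add: \<phi>_def positive_operators_def)
  \<comment> \<open>Each entry \<open>s a\<close> can be recovered from \<open>\<phi> a\<close>.
    This yields the factorization of \<open>s\<close>, injectivity and order reflection.\<close>
  have state: "vector_state (l2 S) (E_lin S) (unit_vector s) (\<phi> a) = s a"
    if "s \<in> S" "a \<in> carrier E" for s a
    unfolding \<phi>_def by (rule vector_state_unit_vector_diagonal_operator) (use nonneg that in auto)
  have "oplus ?F (\<phi> a) (\<phi> b) = Some (\<phi> c)"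
    if "a \<in> carrier E" "b \<in> carrier E" "oplus E a b = Some c" for a b c
  proof -
    have "vadd (l2 S) (\<phi> a x) (\<phi> b x) = \<phi> c x" if x: "x \<in> E_lin S" for x
    proof
      fix s
      show "vadd (l2 S) (\<phi> a x) (\<phi> b x) s = \<phi> c x s"
      \<comment> \<open>On \<open>S\<close> the equation is additivity of the state
        \<open>s\<close>. Families are functions on the whole type, so other indices occur too, and
        there \<open>x\<close> vanishes.\<close>
      proof (cases "s \<in> S")
        case True
        then have "s c = s a + s b"
          using generalized_state_oplus[OF _ \<open>a \<in> carrier E\<close> \<open>b \<in> carrier E\<close>] assms(2)
            \<open>oplus E a b = Some c\<close> by blast
        with x show ?thesis
          by (simp add: \<phi>_def diagonal_operator_def l2_def algebra_simps)
      next
        case False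
        with x show ?thesis
          by (simp add: \<phi>_def diagonal_operator_def E_lin_def l2_def)
      qed
    qed
    then have "(\<lambda>x\<in>E_lin S. vadd (l2 S) (\<phi> a x) (\<phi> b x)) = \<phi> c"
      by (intro extensionalityI[of _ "E_lin S"]) (auto simp: \<phi>_def diagonal_operator_def)
    then show ?thesis
      by (simp add: positive_operators_def)
  qed
  then have morphism: "morphism E ?F \<phi>"
    using carrier by (auto simp: morphism_def)
  have states: "\<exists>x\<in>E_lin S. s = compose (carrier E) (vector_state (l2 S) (E_lin S) x) \<phi>"
    if "s \<in> S" for s
  proof
    show "unit_vector s \<in> E_lin S"
      using that by (rule unit_vector_in_E_lin)
    \<comment> \<open>The required equation is between total functions. Both sides are extensional,
      so agreement on the carrier is enough.\<close>
    have "s \<in> extensional (carrier E)"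
      using that assms(2) by (auto simp: generalized_states_def)
    then show "s = compose (carrier E) (vector_state (l2 S) (E_lin S) (unit_vector s)) \<phi>"
      by (rule extensionalityI) (use that state in \<open>auto simp: compose_def\<close>)
  qed
  have cont: "continuous_map ?X (operator_topology (l2 S) (E_lin S)) \<phi>"
    unfolding operator_topology_def
  proof (rule continuous_map_into_weak_topology)
    show "\<phi> \<in> topspace ?X \<rightarrow> carrier ?F"
      using carrier by (auto simp: topspace_weak_topology)
    fix t
    assume "t \<in> vector_states (l2 S) (E_lin S)"
    then obtain x where x: "x \<in> E_lin S" and t: "t = vector_state (l2 S) (E_lin S) x"
      by (auto simp: vector_states_def)
    let ?N = "{s \<in> S. x s \<noteq> 0}"
    \<comment> \<open>Finite support of \<open>x\<close> is decisive: the composite is a finite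
      combination of states with nonnegative coefficients, hence continuous.\<close>
    have eq: "t (\<phi> a) = (\<Sum>s\<in>?N. s a * (cmod (x s))\<^sup>2)" if "a \<in> carrier E" for a
      unfolding t \<phi>_def by (rule vector_state_diagonal_operator) (use nonneg that x in auto)
    have "continuous_map ?X euclideanreal s" if "s \<in> S" for s
      using continuous_map_weak_topology_state[OF that assms(2)] continuous_map_into_fulltopology
      by blast
    then have "continuous_map ?X euclideanreal (\<lambda>a. \<Sum>s\<in>?N. s a * (cmod (x s))\<^sup>2)"
      using x by (intro continuous_map_sum continuous_map_real_mult) (auto simp: E_lin_def)
    then have "continuous_map ?X euclideanreal (\<lambda>a. t (\<phi> a))"
      by (rule continuous_map_eq) (simp add: eq topspace_weak_topology)
    \<comment> \<open>Continuity was shown into the real line, where sums and products are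
      available; nonnegativity now restricts the codomain.\<close>
    then show "continuous_map ?X (top_of_set {0..}) (\<lambda>a. t (\<phi> a))"
      using nonneg
      by (auto simp: continuous_map_in_subtopology topspace_weak_topology eq intro!: sum_nonneg)
  qed
  have regular: "completely_regular_space ?X"
    by (rule completely_regular_space_weak_topology[OF assms(2)])
  have unit_interval: "\<exists>(T :: ('a \<Rightarrow> real) set) f.
       (\<forall>t\<in>T. continuous_map ?X (top_of_set {0..1::real}) (f t)) \<and>
       separates_points_and_closed_sets ?X (\<lambda>t. top_of_set {0..1}) T f"
    using completely_regular_imp_separates_points_and_closed_sets[OF regular]
    by (intro exI[of _ "{f. continuous_map ?X (top_of_set {0..1}) f}"] exI[of _ id]) simp
  have "inj_on \<phi> (carrier E)" if "separates_points E S"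
  proof (rule inj_onI)
    fix a b
    assume "a \<in> carrier E" "b \<in> carrier E" "\<phi> a = \<phi> b"
    then show "a = b"
      using that state[of _ a] state[of _ b] by (auto simp: separates_points_def)
  qed
  then have separating: "inj_on \<phi> (carrier E) \<and> tychonoff_space ?X" if "separates_points E S"
    using that regular t1_space_weak_topology[OF assms(2)] by (simp add: tychonoff_space_def)
  have "pa_le E a b"
    if "order_determining E S" "a \<in> carrier E" "b \<in> carrier E" "pa_le ?F (\<phi> a) (\<phi> b)" for a b
  proof -
    \<comment> \<open>Comparing the two operators at the unit vector of \<open>s\<close> compares
      their entries at \<open>s\<close>.\<close>
    have "s a \<le> s b" if "s \<in> S" for s
      using vector_state_mono[OF \<open>pa_le ?F (\<phi> a) (\<phi> b)\<close> carrier carrier unit_vector_in_E_lin[OF that]]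
        \<open>a \<in> carrier E\<close> \<open>b \<in> carrier E\<close> by (simp add: state that)
    with that show ?thesis
      by (simp add: order_determining_def)
  qed
  then have reflecting: "order_reflecting E ?F \<phi>" if "order_determining E S"
    using that by (simp add: order_reflecting_def)
  have bounded: "bounded_operator (l2 S) (E_lin S) (\<phi> a)"
    if bdd: "bounded_states E S" and a: "a \<in> carrier E" for a
  proof -
    \<comment> \<open>For fixed \<open>a\<close> the bound is uniform in \<open>s\<close>, so it
      bounds all diagonal entries of \<open>\<phi> a\<close> at once.\<close>
    obtain c where "\<And>s. s \<in> S \<Longrightarrow> s a \<le> c"
      using bdd a unfolding bounded_states_def by blast
    then show ?thesis
      unfolding \<phi>_def using nonneg a
      by (intro bounded_operator_diagonal_operator[of _ _ c]) auto
  qed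
  show ?thesis
    using morphism states cont unit_interval separating reflecting bounded
    by (intro exI[of _ \<phi>] conjI) blast+
qed

end
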